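(* For a finite group $G$, let $\beta(G)$ denote the minimum number of points of a finite poset whose automorphism group is isomorphic to $G$. Then: (1) $\beta(\mathbb{Z}_2)=2$. (2) $2^{k+1}\le \beta(\mathbb{Z}_{2^k})\le 2^{k+1}+12$ for every integer $k\ge 2$. (3) $2p^k\le \beta(\mathbb{Z}_{p^k})\le 2p^k+3p$ for $p\in\{3,5\}$ and every integer $k\ge 1$. (4) $2p^k\le \beta(\mathbb{Z}_{p^k})\le 2p^k+p$ for every prime $p\ge 7$ and every integer $k\ge 1$.
   Context: A poset is a partially ordered set. An automorphism of a poset $P$ is a bijection $\varphi: P\to P$ such that $x\le y$ if and only if $\varphi(x)\le\varphi(y)$; the automorphism group $\mathrm{Aut}(P)$ is the group of all automorphisms under composition. $\mathbb{Z}_n$ denotes the cyclic group of order $n$. *)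

theory Defs
  imports
    "HOL-Algebra.Bij"
    "HOL-Algebra.Elementary_Groups"
    "HOL-Computational_Algebra.Primes"
begin

definition poset_auts :: "'a set \<Rightarrow> 'a rel \<Rightarrow> ('a \<Rightarrow> 'a) set" where
  "poset_auts A r = {f \<in> Bij A. \<forall>x\<in>A. \<forall>y\<in>A. (x, y) \<in> r \<longleftrightarrow> (f x, f y) \<in> r}"

definition poset_aut_group :: "'a set \<Rightarrow> 'a rel \<Rightarrow> ('a \<Rightarrow> 'a) monoid" where
  "poset_aut_group A r = BijGroup A \<lparr>carrier := poset_auts A r\<rparr>"

text \<open>
  The points are taken in \<^typ>\<open>nat\<close>, which is no restriction since every finite poset is
  isomorphic to one on natural numbers; see \<open>poset_beta_le\<close> below. The minimum is over
  a nonempty set for every finite group (Birkhoff).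
\<close>

definition poset_beta :: "('g, 'm) monoid_scheme \<Rightarrow> nat" where
  "poset_beta G = (LEAST n. \<exists>(A :: nat set) r.
     finite A \<and> card A = n \<and> partial_order_on A r \<and> poset_aut_group A r \<cong> G)"

lemma subgroup_poset_auts: "subgroup (poset_auts A r) (BijGroup A)"
proof (rule group.subgroupI[OF group_BijGroup])
  show "poset_auts A r \<subseteq> carrier (BijGroup A)"
    by (auto simp: poset_auts_def BijGroup_def)
  show "poset_auts A r \<noteq> {}"
    using id_Bij[of A] by (auto simp: poset_auts_def intro!: exI[of _ "\<lambda>x\<in>A. x"])
next
  fix f assume f: "f \<in> poset_auts A r"
  then have b: "f \<in> Bij A" by (simp add: poset_auts_def)
  have "(x, y) \<in> r \<longleftrightarrow> (inv_into A f x, inv_into A f y) \<in> r" if "x \<in> A" "y \<in> A" for x y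
    using f that Bij_inv_into_mem[OF b]
    by (auto simp: poset_auts_def Bij_def bij_betw_def f_inv_into_f)
  then show "inv\<^bsub>BijGroup A\<^esub> f \<in> poset_auts A r"
    using b restrict_inv_into_Bij[OF b] by (simp add: inv_BijGroup poset_auts_def)
next
  fix f g assume f: "f \<in> poset_auts A r" and g: "g \<in> poset_auts A r"
  then have b: "f \<in> Bij A" "g \<in> Bij A" by (simp_all add: poset_auts_def)
  have m: "g x \<in> A" if "x \<in> A" for x
    using Bij_imp_funcset[OF b(2)] that by auto
  show "f \<otimes>\<^bsub>BijGroup A\<^esub> g \<in> poset_auts A r"
    using f g b m compose_Bij[OF b] by (simp add: BijGroup_def poset_auts_def compose_eq)
qed

lemma group_poset_aut_group: "group (poset_aut_group A r)"
  unfolding poset_aut_group_def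
  by (rule subgroup.subgroup_is_group[OF subgroup_poset_auts group_BijGroup])

lemma poset_transport:
  fixes A :: "'a set" and h :: "'a \<Rightarrow> 'b"
  assumes po: "partial_order_on A r" and inj: "inj_on h A"
  defines "B \<equiv> h ` A" and "s \<equiv> map_prod h h ` r"
  shows "partial_order_on B s" and "poset_aut_group A r \<cong> poset_aut_group B s"
proof -
  have rA: "r \<subseteq> A \<times> A" using po by (rule partial_order_onD)
  have s: "(h x, h y) \<in> s \<longleftrightarrow> (x, y) \<in> r" if "x \<in> A" "y \<in> A" for x y
  proof
    assume "(h x, h y) \<in> s"
    then obtain u v where "(u, v) \<in> r" "h x = h u" "h y = h v" by (auto simp: s_def)
    with rA inj that show "(x, y) \<in> r" by (auto dest: inj_onD)
  qed (force simp: s_def)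
  have sB: "s \<subseteq> B \<times> B" using rA by (auto simp: s_def B_def)
  have refl: "refl_on B s"
    using partial_order_onD(1)[OF po] s by (auto simp: refl_on_def B_def)
  have tr: "trans s"
  proof (rule transI)
    fix a b c assume ab: "(a, b) \<in> s" and bc: "(b, c) \<in> s"
    then obtain x y z where "x \<in> A" "y \<in> A" "z \<in> A" "a = h x" "b = h y" "c = h z"
      using sB unfolding B_def by blast
    with ab bc s partial_order_onD(2)[OF po] show "(a, c) \<in> s" by (auto dest: transD)
  qed
  have "antisym s"
  proof (rule antisymI)
    fix a b assume ab: "(a, b) \<in> s" and ba: "(b, a) \<in> s"
    then obtain x y where "x \<in> A" "y \<in> A" "a = h x" "b = h y"
      using sB unfolding B_def by blast
    with ab ba s partial_order_onD(3)[OF po] show "a = b" by (auto dest: antisymD)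
  qed
  with sB refl tr show "partial_order_on B s"
    by (simp add: partial_order_on_def preorder_on_def)
  define g where "g = inv_into A h"
  have gh: "g (h x) = x" if "x \<in> A" for x using inj that by (simp add: g_def)
  define T where "T = (\<lambda>f. \<lambda>b\<in>B. h (f (g b)))"
  define U where "U = (\<lambda>f. \<lambda>x\<in>A. g (f (h x)))"
  have bh: "bij_betw h A B" using inj by (simp add: bij_betw_def B_def)
  have bg: "bij_betw g B A" unfolding g_def by (rule bij_betw_inv_into[OF bh])
  have hg: "h (g b) = b" if "b \<in> B" for b
    using that by (simp add: g_def B_def f_inv_into_f)
  have T_mem: "T f \<in> poset_auts B s" if f: "f \<in> poset_auts A r" for f
  proof -
    have bf: "bij_betw f A A" using f by (simp add: poset_auts_def Bij_def)
    have "bij_betw (h \<circ> f \<circ> g) B B" using bh bf bg by (meson bij_betw_trans)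
    then have "bij_betw (T f) B B"
      by (rule bij_betw_cong[THEN iffD1, rotated]) (simp add: T_def)
    moreover have "(b, c) \<in> s \<longleftrightarrow> (T f b, T f c) \<in> s" if "b \<in> B" "c \<in> B" for b c
    proof -
      have m: "g b \<in> A" "g c \<in> A" using bg that by (auto simp: bij_betw_def)
      then have m': "f (g b) \<in> A" "f (g c) \<in> A" using bf by (auto simp: bij_betw_def)
      have "(b, c) \<in> s \<longleftrightarrow> (g b, g c) \<in> r" using s[OF m] that by (simp add: hg)
      also have "\<dots> \<longleftrightarrow> (f (g b), f (g c)) \<in> r" using f m by (simp add: poset_auts_def)
      finally show ?thesis using s[OF m'] that by (simp add: T_def)
    qed
    ultimately show ?thesis by (simp add: poset_auts_def Bij_def T_def)
  qed
  have U_mem: "U f \<in> poset_auts A r" if f: "f \<in> poset_auts B s" for f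
  proof -
    have bf: "bij_betw f B B" using f by (simp add: poset_auts_def Bij_def)
    have "bij_betw (g \<circ> f \<circ> h) A A" using bh bf bg by (meson bij_betw_trans)
    then have "bij_betw (U f) A A"
      by (rule bij_betw_cong[THEN iffD1, rotated]) (simp add: U_def)
    moreover have "(x, y) \<in> r \<longleftrightarrow> (U f x, U f y) \<in> r" if "x \<in> A" "y \<in> A" for x y
    proof -
      have m: "h x \<in> B" "h y \<in> B" using that by (auto simp: B_def)
      then have m': "f (h x) \<in> B" "f (h y) \<in> B" using bf by (auto simp: bij_betw_def)
      then have m'': "g (f (h x)) \<in> A" "g (f (h y)) \<in> A" using bg by (auto simp: bij_betw_def)
      have "(x, y) \<in> r \<longleftrightarrow> (h x, h y) \<in> s" using s that by simp
      also have "\<dots> \<longleftrightarrow> (f (h x), f (h y)) \<in> s" using f m by (simp add: poset_auts_def)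
      finally show ?thesis using s[OF m''] m' that by (simp add: U_def hg)
    qed
    ultimately show ?thesis by (simp add: poset_auts_def Bij_def U_def)
  qed
  have maps: "f x \<in> A" if "f \<in> poset_auts A r" "x \<in> A" for f x
    using that by (auto simp: poset_auts_def Bij_def bij_betw_def)
  have maps': "f x \<in> B" if "f \<in> poset_auts B s" "x \<in> B" for f x
    using that by (auto simp: poset_auts_def Bij_def bij_betw_def)
  have hB: "h x \<in> B" if "x \<in> A" for x using that by (simp add: B_def)
  have gA: "g b \<in> A" if "b \<in> B" for b using bg that by (auto simp: bij_betw_def)
  have "bij_betw T (poset_auts A r) (poset_auts B s)"
  proof (rule bij_betw_byWitness[where f' = U])
    show "\<forall>f\<in>poset_auts A r. U (T f) = f"
    proof
      fix f assume f: "f \<in> poset_auts A r"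
      then have "f \<in> extensional A" by (simp add: poset_auts_def Bij_def)
      then show "U (T f) = f"
        by (intro extensionalityI[of _ A]) (simp_all add: U_def T_def hB gh maps f)
    qed
    show "\<forall>f\<in>poset_auts B s. T (U f) = f"
    proof
      fix f assume f: "f \<in> poset_auts B s"
      then have "f \<in> extensional B" by (simp add: poset_auts_def Bij_def)
      then show "T (U f) = f"
        by (intro extensionalityI[of _ B]) (simp_all add: U_def T_def gA hg maps' f)
    qed
  qed (use T_mem U_mem in auto)
  moreover have "T (compose A f f') = compose B (T f) (T f')"
    if "f \<in> poset_auts A r" "f' \<in> poset_auts A r" for f f'
    by (rule extensionalityI[of _ B]) (simp_all add: T_def compose_def gA hB gh maps that)
  moreover have "f \<in> Bij A" if "f \<in> poset_auts A r" for f
    using that by (simp add: poset_auts_def)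
  moreover have "f \<in> Bij B" if "f \<in> poset_auts B s" for f
    using that by (simp add: poset_auts_def)
  ultimately have "T \<in> iso (poset_aut_group A r) (poset_aut_group B s)"
    using T_mem by (auto simp: iso_def hom_def poset_aut_group_def BijGroup_def)
  then show "poset_aut_group A r \<cong> poset_aut_group B s" by (rule is_isoI)
qed

lemma poset_beta_le:
  fixes A :: "'a set"
  assumes "finite A" and po: "partial_order_on A r" and iso: "poset_aut_group A r \<cong> G"
  shows "poset_beta G \<le> card A"
proof -
  obtain h :: "'a \<Rightarrow> nat" where h: "inj_on h A"
    using finite_imp_inj_to_nat_seg[OF \<open>finite A\<close>] by blast
  let ?s = "map_prod h h ` r"
  have "poset_aut_group (h ` A) ?s \<cong> G"
    by (rule group.iso_sym[OF group_poset_aut_group poset_transport(2)[OF po h], THEN iso_trans, OF iso])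
  moreover have "finite (h ` A)" "card (h ` A) = card A"
    using \<open>finite A\<close> h by (simp_all add: card_image)
  ultimately show ?thesis
    unfolding poset_beta_def using poset_transport(1)[OF po h]
    by (intro Least_le exI conjI)
qed

end

theory Submission
  imports Defs "HOL-Number_Theory.Cong"
begin

text \<open>
  \<^emph>\<open>Lower bounds.\<close> Let \<open>\<int>/n\<close> with \<open>n = p\<^sup>k\<close> act on a finite poset as its full automorphism group,
  and let \<open>h\<close> be the action of \<open>p\<^bsup>k-1\<^esup>\<close>. Every nontrivial subgroup of \<open>\<int>/n\<close> contains
  \<open>p\<^bsup>k-1\<^esup>\<close>, so a point moved by \<open>h\<close> has trivial stabilizer and an orbit of \<open>n\<close> points; such a point
  \<open>x\<close> exists because \<open>h \<noteq> id\<close>. If the poset had fewer than \<open>2n\<close> points, there would be no room for a second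
  orbit of this size, so \<open>h\<close> would fix everything outside the orbit of \<open>x\<close>. Then \<open>x\<close> and \<open>h x\<close> have
  the same relations to the points outside the orbit, and inside the orbit, which is an antichain,
  nothing is related. Exchanging \<open>x\<close> and \<open>h x\<close> is therefore an automorphism. For \<open>n \<ge> 3\<close> it fixes
  a third point of the orbit, which only the neutral element of \<open>\<int>/n\<close> does: a contradiction
  (\<open>card_ge_twice_order\<close>).

  \<^emph>\<open>Upper bounds.\<close> Stack copies of \<open>\<int>/n\<close> as layers and relate points of different layers by their
  difference only, so that simultaneous rotation of all layers is an automorphism. The relations are
  chosen such that there are no other automorphisms. Three layers suffice for every \<open>n \<ge> 2\<close>
  (\<open>three_layers_aut\<close>): two bijections tie the layers together, and the extra relation from
  \<open>i\<close> at the bottom to \<open>i + 1\<close> at the top makes the bottom layer a directed cycle. Two layers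
  suffice for \<open>n \<ge> 11\<close> (\<open>two_layers_aut\<close>), with \<open>i\<close> below \<open>i + d\<close> for \<open>d \<in> {0, 1, 2, 5}\<close>: the
  only difference that occurs twice in this set is 1, so two lower points have two common upper bounds
  iff they are neighbours on the cycle, and no reflection maps the set to a translate of itself modulo \<open>n\<close>.

  Since \<open>2n\<close> points suffice from \<open>n = 11\<close> on and \<open>3n\<close> points always do, an upper bound of the form
  \<open>2n + c\<close> holds as soon as every \<open>n \<le> 10\<close> in question is at most \<open>c\<close>. Prime powers make this true for
  the stated excesses; the tightest cases are \<open>n = 7\<close> and \<open>n = 9\<close>, where \<open>c = n\<close>. For \<open>n = 2\<close> the lower
  bound is just the size of one orbit (\<open>card_ge_order\<close>), and a two-point antichain attains it.
\<close>

section \<open>Automorphisms of finite posets\<close>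

text \<open>
  \<open>poset_beta\<close> is a least element, so it has the properties of a realization only if some realization
  exists; any realization, on points of any type, can be carried over to natural numbers.
\<close>

lemma poset_beta_attained:
  fixes A :: "'a set"
  assumes "finite A" and po: "partial_order_on A r" and iso: "poset_aut_group A r \<cong> G"
  obtains B :: "nat set" and s where "finite B" "card B = poset_beta G" "partial_order_on B s"
    "poset_aut_group B s \<cong> G"
proof -
  obtain h :: "'a \<Rightarrow> nat" where h: "inj_on h A"
    using finite_imp_inj_to_nat_seg[OF \<open>finite A\<close>] by blast
  let ?s = "map_prod h h ` r"
  have "poset_aut_group (h ` A) ?s \<cong> G"
    by (rule group.iso_sym[OF group_poset_aut_group poset_transport(2)[OF po h], THEN iso_trans, OF iso])
  moreover have "finite (h ` A)" using \<open>finite A\<close> by simp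
  ultimately have "\<exists>n. \<exists>(B :: nat set) s.
      finite B \<and> card B = n \<and> partial_order_on B s \<and> poset_aut_group B s \<cong> G"
    using poset_transport(1)[OF po h] by blast
  from LeastI_ex[OF this] show thesis
    using that unfolding poset_beta_def by blast
qed

lemma poset_aut_closed: "f \<in> poset_auts A r \<Longrightarrow> x \<in> A \<Longrightarrow> f x \<in> A"
  by (auto simp: poset_auts_def Bij_def bij_betw_def)

lemma poset_aut_inj: "f \<in> poset_auts A r \<Longrightarrow> x \<in> A \<Longrightarrow> y \<in> A \<Longrightarrow> f x = f y \<longleftrightarrow> x = y"
  by (auto simp: poset_auts_def Bij_def bij_betw_def dest: inj_onD)

lemma poset_aut_rel:
  "f \<in> poset_auts A r \<Longrightarrow> x \<in> A \<Longrightarrow> y \<in> A \<Longrightarrow> (f x, f y) \<in> r \<longleftrightarrow> (x, y) \<in> r"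
  by (auto simp: poset_auts_def)

text \<open>
  The down-sets of \<open>x\<close> and \<open>f x\<close> have the same size, because \<open>f\<close> maps one onto the other. If the
  points are comparable, one down-set contains the other, so the two coincide.
\<close>

lemma poset_aut_comparable_fixed:
  assumes "finite A" and po: "partial_order_on A r" and f: "f \<in> poset_auts A r"
    and x: "x \<in> A" and cmp: "(x, f x) \<in> r \<or> (f x, x) \<in> r"
  shows "f x = x"
proof -
  let ?D = "\<lambda>y. {z \<in> A. (z, y) \<in> r}"
  have fA: "f ` A = A" and inj: "inj_on f A"
    using f by (auto simp: poset_auts_def Bij_def bij_betw_def)
  have "f ` ?D x = ?D (f x)"
  proof (intro equalityI subsetI)
    fix y assume y: "y \<in> ?D (f x)"
    then obtain z where "z \<in> A" "y = f z" using fA by blast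
    then show "y \<in> f ` ?D x" using y x poset_aut_rel[OF f] by auto
  qed (use x poset_aut_rel[OF f] poset_aut_closed[OF f] in auto)
  moreover have "card (f ` ?D x) = card (?D x)"
    by (rule card_image, rule inj_on_subset[OF inj]) auto
  ultimately have card: "card (?D (f x)) = card (?D x)" by simp
  have fin: "finite (?D y)" for y using \<open>finite A\<close> by simp
  have refl: "y \<in> ?D y" if "y \<in> A" for y
    using that partial_order_onD(1)[OF po] by (auto simp: refl_on_def)
  have fx: "f x \<in> A" using poset_aut_closed[OF f x] .
  have tr: "trans r" and anti: "antisym r"
    using partial_order_onD[OF po] by auto
  from cmp have "?D x = ?D (f x)"
  proof
    assume "(x, f x) \<in> r"
    then have "?D x \<subseteq> ?D (f x)" using tr by (auto dest: transD)
    then show ?thesis by (rule card_subset_eq[OF fin _ card[symmetric]])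
  next
    assume "(f x, x) \<in> r"
    then have "?D (f x) \<subseteq> ?D x" using tr by (auto dest: transD)
    then show ?thesis by (rule card_subset_eq[OF fin _ card, symmetric])
  qed
  then have "(x, f x) \<in> r" "(f x, x) \<in> r" using refl[OF x] refl[OF fx] by blast+
  then show ?thesis using anti by (auto dest: antisymD)
qed

section \<open>Finite posets with cyclic automorphism group\<close>

text \<open>
  The isomorphism with \<open>\<int>/n\<close> is turned into an action of all integers, which trades the
  reductions modulo \<open>n\<close> for periodicity. The action is described on \<open>A\<close> only, since
  automorphisms take default values elsewhere.
\<close>

locale cyclic_poset =
  fixes A :: "'a set" and r :: "'a rel" and n :: nat and act :: "int \<Rightarrow> 'a \<Rightarrow> 'a"
  assumes fin: "finite A" and po: "partial_order_on A r"
    and act_aut: "act t \<in> poset_auts A r"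
    and act_add: "x \<in> A \<Longrightarrow> act (s + t) x = act s (act t x)"
    and act_period: "x \<in> A \<Longrightarrow> act (t * int n) x = x"
    and act_onto: "f \<in> poset_auts A r \<Longrightarrow> \<exists>t. f = act t"
    and act_faithful: "(\<And>x. x \<in> A \<Longrightarrow> act t x = x) \<Longrightarrow> int n dvd t"

lemma cyclic_posetI:
  assumes "finite A" "partial_order_on A r" "n > 0"
    and iso: "poset_aut_group A r \<cong> integer_mod_group n"
  shows "\<exists>act. cyclic_poset A r n act"
proof -
  let ?G = "poset_aut_group A r" and ?Z = "integer_mod_group n"
  from iso have "?Z \<cong> ?G" by (rule group.iso_sym[OF group_poset_aut_group])
  then obtain \<psi> where \<psi>: "\<psi> \<in> iso ?Z ?G" by (auto simp: is_iso_def)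
  have cZ: "carrier ?Z = {0..<int n}" and mZ: "x \<otimes>\<^bsub>?Z\<^esub> y = (x + y) mod int n" for x y
    using \<open>n > 0\<close> by (auto simp: integer_mod_group_def)
  have cG: "carrier ?G = poset_auts A r" by (simp add: poset_aut_group_def)
  have bij: "bij_betw \<psi> {0..<int n} (poset_auts A r)" and hom: "\<psi> \<in> hom ?Z ?G"
    using \<psi> by (auto simp: iso_def cZ cG)
  define act where "act t = \<psi> (t mod int n)" for t
  have aut: "act t \<in> poset_auts A r" for t
    unfolding act_def by (rule bij_betwE[OF bij, rule_format]) (use \<open>n > 0\<close> in auto)
  have add: "act (s + t) x = act s (act t x)" if "x \<in> A" for s t x
  proof -
    have "act (s + t) = act s \<otimes>\<^bsub>?G\<^esub> act t"
      using hom_mult[OF hom, of "s mod int n" "t mod int n"] \<open>n > 0\<close>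
      by (simp add: act_def cZ mZ mod_simps)
    also have "\<dots> = compose A (act s) (act t)"
      using aut[of s] aut[of t]
      by (simp add: poset_aut_group_def BijGroup_def poset_auts_def)
    finally show ?thesis using that by (simp add: compose_eq)
  qed
  have zero: "act 0 x = x" if x: "x \<in> A" for x
    using add[OF x, of 0 0] poset_aut_inj[OF aut[of 0], of "act 0 x" x]
      poset_aut_closed[OF aut[of 0] x] x by simp
  have onto: "\<exists>t. f = act t" if "f \<in> poset_auts A r" for f
  proof -
    have "f \<in> \<psi> ` {0..<int n}" using that bij by (simp add: bij_betw_def)
    then obtain t where "t \<in> {0..<int n}" "f = \<psi> t" by blast
    then have "f = act t" by (simp add: act_def)
    then show ?thesis ..
  qed
  have faithful: "int n dvd t" if "\<And>x. x \<in> A \<Longrightarrow> act t x = x" for t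
  proof -
    have "act t \<in> extensional A" "act 0 \<in> extensional A"
      using aut by (auto simp: poset_auts_def Bij_def)
    then have "act t = act 0"
      by (rule extensionalityI) (simp add: that zero)
    then have "t mod int n = 0 mod int n"
      using bij \<open>n > 0\<close> unfolding act_def bij_betw_def by (auto dest!: inj_onD)
    then show ?thesis by auto
  qed
  have period: "act (t * int n) x = x" if "x \<in> A" for t x
    using zero[OF that] by (simp add: act_def)
  show ?thesis
    by (intro exI[of _ act] cyclic_poset.intro assms aut add period onto faithful)
qed

context cyclic_poset
begin

lemma act_closed: "x \<in> A \<Longrightarrow> act t x \<in> A"
  using poset_aut_closed[OF act_aut] .

lemma act_commute: "x \<in> A \<Longrightarrow> act s (act t x) = act t (act s x)"
  using act_add[of x s t] act_add[of x t s] by (simp add: add.commute)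

lemma act_zero: "x \<in> A \<Longrightarrow> act 0 x = x"
  using act_period[of x 0] by simp

lemma act_eq_iff: "x \<in> A \<Longrightarrow> act s x = act t x \<longleftrightarrow> act (s - t) x = x"
  using act_add[of x t "s - t"] poset_aut_inj[OF act_aut[of t], of "act (s - t) x" x]
    act_closed by auto

lemma act_fixes_multiple:
  assumes x: "x \<in> A" and fixed: "act t x = x"
  shows "act (u * t) x = x"
proof -
  have nat: "act (int m * t) x = x" for m
    by (induction m) (simp_all add: act_zero x ring_distribs act_add fixed)
  have "act (- (int m * t)) x = x" for m
    using act_eq_iff[OF x, of 0 "int m * t"] by (simp add: nat act_zero x)
  with nat show ?thesis by (cases u rule: int_cases2) auto
qed

definition orbit :: "'a \<Rightarrow> 'a set" where
  "orbit x = range (\<lambda>t. act t x)"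

lemma orbit_subset: "x \<in> A \<Longrightarrow> orbit x \<subseteq> A"
  by (auto simp: orbit_def act_closed)

lemma orbit_act: "x \<in> A \<Longrightarrow> y \<in> orbit x \<Longrightarrow> act t y \<in> orbit x"
  by (auto simp: orbit_def simp flip: act_add)

lemma orbit_sym:
  assumes x: "x \<in> A" and "y \<in> orbit x"
  shows "x \<in> orbit y"
proof -
  from assms obtain t where "y = act t x" by (auto simp: orbit_def)
  then have "act (- t) y = x" using act_add[OF x, of "- t" t] act_zero[OF x] by simp
  then show ?thesis unfolding orbit_def by blast
qed

lemma orbit_disjoint:
  assumes x: "x \<in> A" and y: "y \<in> A" "y \<notin> orbit x"
  shows "orbit x \<inter> orbit y = {}"
proof -
  have False if z: "z \<in> orbit x" "z \<in> orbit y" for z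
  proof -
    have "y \<in> orbit z" using orbit_sym[OF y(1) z(2)] .
    then obtain t where "y = act t z" by (auto simp: orbit_def)
    then show False using orbit_act[OF x z(1)] y(2) by simp
  qed
  then show ?thesis by blast
qed

text \<open>
  Any point of an orbit is the image of any other under an automorphism, so distinct points of it
  are incomparable by \<open>poset_aut_comparable_fixed\<close>.
\<close>

lemma orbit_antichain:
  assumes x: "x \<in> A" and y: "y \<in> orbit x" and z: "z \<in> orbit x" and "(y, z) \<in> r"
  shows "y = z"
proof -
  have yA: "y \<in> A" using orbit_subset[OF x] y by blast
  have "x \<in> orbit y" using orbit_sym[OF x y] .
  then obtain s where s: "x = act s y" by (auto simp: orbit_def)
  obtain t where "z = act t x" using z by (auto simp: orbit_def)
  then have "z = act (t + s) y" using s yA by (simp add: act_add)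
  then show ?thesis
    using poset_aut_comparable_fixed[OF fin po act_aut yA] \<open>(y, z) \<in> r\<close> by metis
qed

context
  fixes p k :: nat
  assumes p: "prime p" and k: "k \<ge> 1" and n: "n = p ^ k"
begin

text \<open>
  If \<open>t\<close> is not divisible by \<open>n = p\<^sup>k\<close>, then \<open>gcd t n\<close> is \<open>p\<^sup>j\<close> with \<open>j < k\<close>, so by Bezout
  \<open>p\<^bsup>k-1\<^esup>\<close> is a multiple of \<open>t\<close> modulo \<open>n\<close> and its action fixes whatever \<open>t\<close> fixes.
\<close>

lemma moved_point_stabilizer_trivial:
  assumes x: "x \<in> A" and moved: "act (int p ^ (k - 1)) x \<noteq> x" and fixed: "act t x = x"
  shows "int n dvd t"
proof (rule ccontr)
  assume nt: "\<not> int n dvd t"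
  define g where "g = nat (gcd t (int n))"
  have g: "int g = gcd t (int n)" by (simp add: g_def)
  have "int g dvd int n" by (simp add: g)
  then have "g dvd p ^ k" unfolding n by (simp only: of_nat_dvd_iff)
  then obtain j where j: "j \<le> k" "g = p ^ j" using divides_primepow_nat[OF p] by blast
  have "j \<noteq> k"
  proof
    assume "j = k"
    then have "int n = gcd t (int n)" using g j(2) n by simp
    then show False using nt gcd_dvd1[of t "int n"] by simp
  qed
  then have "j \<le> k - 1" using j by simp
  then have "int p ^ (k - 1) = int p ^ j * int p ^ (k - 1 - j)"
    by (metis le_add_diff_inverse power_add)
  then have gp: "int p ^ (k - 1) = int g * int p ^ (k - 1 - j)"
    by (simp only: j(2) of_nat_power)
  obtain u v where "u * t + v * int n = int g" using bezout_int[of t "int n"] unfolding g by blast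
  from this[symmetric] have e: "int p ^ (k - 1) =
      (int p ^ (k - 1 - j) * u) * t + (int p ^ (k - 1 - j) * v) * int n"
    unfolding gp by (simp add: algebra_simps)
  have "act (int p ^ (k - 1)) x = x"
    by (simp only: e act_add[OF x] act_period[OF x] act_fixes_multiple[OF x fixed])
  with moved show False ..
qed

lemma card_orbit_moved_point:
  assumes x: "x \<in> A" and moved: "act (int p ^ (k - 1)) x \<noteq> x"
  shows "n \<le> card (orbit x)"
proof -
  have "inj_on (\<lambda>t. act t x) {0..<int n}"
  proof (rule inj_onI)
    fix s t assume st: "s \<in> {0..<int n}" "t \<in> {0..<int n}" and "act s x = act t x"
    then have "int n dvd s - t"
      using moved_point_stabilizer_trivial[OF x moved] act_eq_iff[OF x] by blast
    then show "s = t" using st by (auto simp flip: mod_eq_dvd_iff)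
  qed
  then have "card ((\<lambda>t. act t x) ` {0..<int n}) = n" by (simp add: card_image)
  moreover have "finite (orbit x)" using orbit_subset[OF x] fin by (rule finite_subset)
  ultimately show ?thesis by (metis card_mono image_mono orbit_def subset_UNIV)
qed

lemma moved_point_exists: "\<exists>x\<in>A. act (int p ^ (k - 1)) x \<noteq> x"
proof (rule ccontr)
  assume "\<not> ?thesis"
  then have "int n dvd int p ^ (k - 1)" by (intro act_faithful) auto
  then have "int (p ^ k) dvd int (p ^ (k - 1))" by (simp add: n)
  then have "p ^ k dvd p ^ (k - 1)" by (simp only: of_nat_dvd_iff)
  then have "k \<le> k - 1"
    using p by (simp add: dvd_power_iff_le prime_ge_2_nat)
  with k show False by simp
qed

lemma card_ge_order: "n \<le> card A"
proof -
  obtain x where x: "x \<in> A" "act (int p ^ (k - 1)) x \<noteq> x" using moved_point_exists by blast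
  have "card (orbit x) \<le> card A" using orbit_subset[OF x(1)] fin by (simp add: card_mono)
  then show ?thesis using card_orbit_moved_point[OF x] by simp
qed

text \<open>
  With fewer than \<open>2n\<close> points, exchanging a moved point \<open>x\<close> with its image \<open>h x\<close> is an
  automorphism that fixes some point \<open>z\<close> of the orbit of \<open>x\<close>. Since the group is commutative and
  transitive on this orbit, an element that fixes \<open>z\<close> also fixes \<open>x\<close>, which the exchange does not.
\<close>

lemma card_ge_twice_order:
  assumes "n \<ge> 3"
  shows "2 * n \<le> card A"
proof (rule ccontr)
  assume small: "\<not> ?thesis"
  define h where "h = act (int p ^ (k - 1))"
  obtain x where x: "x \<in> A" and hx: "h x \<noteq> x" using moved_point_exists by (auto simp: h_def)
  have h: "h \<in> poset_auts A r" by (simp add: h_def act_aut)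
  have cO: "n \<le> card (orbit x)" using card_orbit_moved_point[OF x] hx by (simp add: h_def)
  have OA: "orbit x \<subseteq> A" and fO: "finite (orbit x)"
    using orbit_subset[OF x] fin by (auto intro: finite_subset)
  have xO: "x \<in> orbit x" using act_zero[OF x] by (auto simp: orbit_def intro: range_eqI[of _ _ 0])
  have hxO: "h x \<in> orbit x" by (simp add: orbit_def h_def)
  \<comment> \<open>A second moved orbit would bring the number of points to \<open>2n\<close>.\<close>
  have fixed: "h y = y" if y: "y \<in> A" "y \<notin> orbit x" for y
  proof (rule ccontr)
    assume "h y \<noteq> y"
    then have "n \<le> card (orbit y)" using card_orbit_moved_point[OF y(1)] by (simp add: h_def)
    moreover have "finite (orbit y)" using orbit_subset[OF y(1)] fin by (rule finite_subset)
    then have "card (orbit x \<union> orbit y) = card (orbit x) + card (orbit y)"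
      using orbit_disjoint[OF x y] fO by (simp add: card_Un_disjoint)
    moreover have "card (orbit x \<union> orbit y) \<le> card A"
      using OA orbit_subset[OF y(1)] fin by (simp add: card_mono)
    ultimately show False using cO small by simp
  qed
  \<comment> \<open>The point \<open>z\<close> exists only because \<open>n \<ge> 3\<close>; for \<open>n = 2\<close> the exchange is \<open>h\<close> itself on the orbit.\<close>
  obtain z where z: "z \<in> orbit x" "z \<noteq> x" "z \<noteq> h x"
  proof -
    have "card {x, h x} < card (orbit x)" using hx cO \<open>n \<ge> 3\<close> by simp
    then have "\<not> orbit x \<subseteq> {x, h x}" using card_mono[of "{x, h x}" "orbit x"] by auto
    then show thesis using that by blast
  qed
  define \<tau> where "\<tau> = (\<lambda>y\<in>A. if y = x then h x else if y = h x then x else y)"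
  have hxA: "h x \<in> A" using hxO OA by blast
  have \<tau>_in: "\<tau> y \<in> A" and \<tau>_\<tau>: "\<tau> (\<tau> y) = y" and \<tau>_orbit: "\<tau> y \<in> orbit x \<longleftrightarrow> y \<in> orbit x"
    if "y \<in> A" for y
    using that x hxA hx xO hxO by (auto simp: \<tau>_def)
  have bij: "bij_betw \<tau> A A"
    by (rule bij_betw_byWitness[where f' = \<tau>]) (use \<tau>_in \<tau>_\<tau> in auto)
  have off: "\<tau> y = y" if "y \<in> A" "y \<notin> orbit x" for y
    using that xO hxO by (auto simp: \<tau>_def)
  have hrel: "(h x, y) \<in> r \<longleftrightarrow> (x, y) \<in> r" "(y, h x) \<in> r \<longleftrightarrow> (y, x) \<in> r"
    if y: "y \<in> A" "y \<notin> orbit x" for y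
    using poset_aut_rel[OF h x y(1)] poset_aut_rel[OF h y(1) x] fixed[OF y] by auto
  have rel: "(a, b) \<in> r \<longleftrightarrow> (\<tau> a, \<tau> b) \<in> r" if a: "a \<in> A" and b: "b \<in> A" for a b
  proof -
    have refl: "(c, c) \<in> r" if "c \<in> A" for c
      using that partial_order_onD(1)[OF po] by (auto simp: refl_on_def)
    consider "a \<in> orbit x" "b \<in> orbit x" | "a \<in> orbit x" "b \<notin> orbit x"
      | "a \<notin> orbit x" "b \<in> orbit x" | "a \<notin> orbit x" "b \<notin> orbit x" by blast
    then show ?thesis
    proof cases
      case 1
      have "(a, b) \<in> r \<longleftrightarrow> a = b" using orbit_antichain[OF x 1] refl[OF a] by auto
      also have "\<dots> \<longleftrightarrow> \<tau> a = \<tau> b" by (metis \<tau>_\<tau> a b)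
      also have "\<dots> \<longleftrightarrow> (\<tau> a, \<tau> b) \<in> r"
        using orbit_antichain[OF x, of "\<tau> a" "\<tau> b"] \<tau>_orbit[OF a] \<tau>_orbit[OF b] 1
          refl[OF \<tau>_in[OF a]] by metis
      finally show ?thesis .
    next
      case 2
      then show ?thesis using a b off[OF b] hrel[OF b] by (auto simp: \<tau>_def)
    next
      case 3
      then show ?thesis using a b off[OF a] hrel[OF a] by (auto simp: \<tau>_def)
    next
      case 4
      then show ?thesis using a b off by simp
    qed
  qed
  have "\<tau> \<in> poset_auts A r"
    using bij rel by (simp add: poset_auts_def Bij_def \<tau>_def)
  then obtain t where t: "\<tau> = act t" using act_onto by blast
  obtain s where s: "z = act s x" using z(1) by (auto simp: orbit_def)
  have "act t z = z" using z OA by (auto simp: \<tau>_def simp flip: t)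
  then have "act s (act t x) = act s x" using act_commute[OF x] s by simp
  then have "act t x = x" using poset_aut_inj[OF act_aut act_closed[OF x] x] by simp
  moreover have "act t x = h x" using x by (simp add: \<tau>_def flip: t)
  ultimately show False using hx by simp
qed

end

end

section \<open>Layered posets with a cyclic symmetry\<close>

definition layers :: "nat \<Rightarrow> nat \<Rightarrow> (nat \<times> int) set" where
  "layers L n = {0..<L} \<times> {0..<int n}"

text \<open>
  The elements of \<open>D l m\<close> are the differences \<open>j - i\<close> for which the point \<open>i\<close> of layer \<open>l\<close> lies
  below the point \<open>j\<close> of the higher layer \<open>m\<close>. They are read modulo \<open>n\<close>, so \<open>D\<close> itself can consist of
  small integers independent of \<open>n\<close>.
\<close>

definition layer_order :: "nat \<Rightarrow> nat \<Rightarrow> (nat \<Rightarrow> nat \<Rightarrow> int set) \<Rightarrow> (nat \<times> int) rel" where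
  "layer_order L n D = {((l, i), (m, j)) | l i m j. (l, i) \<in> layers L n \<and> (m, j) \<in> layers L n \<and>
     (l = m \<and> i = j \<or> l < m \<and> (\<exists>d\<in>D l m. [j - i = d] (mod int n)))}"

lemma finite_layers: "finite (layers L n)" and card_layers: "card (layers L n) = L * n"
  by (simp_all add: layers_def)

lemma layers_mod: "n > 0 \<Longrightarrow> (l, i mod int n) \<in> layers L n \<longleftrightarrow> l < L"
  by (auto simp: layers_def)

lemma layers_cases:
  assumes "x \<in> layers L n"
  obtains l i where "l < L" "x = (l, i mod int n)"
proof (cases x)
  case (Pair l i)
  then have "l < L" "x = (l, i mod int n)" using assms by (simp_all add: layers_def)
  then show thesis by (rule that)
qed

lemma layer_order_iff:
  assumes "n > 0" "l < L" "m < L"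
  shows "((l, i mod int n), (m, j mod int n)) \<in> layer_order L n D \<longleftrightarrow>
    l = m \<and> [i = j] (mod int n) \<or> l < m \<and> (\<exists>d\<in>D l m. [j - i = d] (mod int n))"
proof -
  have "[j mod int n - i mod int n = d] (mod int n) \<longleftrightarrow> [j - i = d] (mod int n)" for d
    by (simp add: cong_def mod_simps)
  then show ?thesis using assms by (simp add: layer_order_def layers_mod) (simp add: cong_def)
qed

lemma partial_order_layer_order:
  assumes "n > 0"
    and comp: "\<And>l m q a b. l < m \<Longrightarrow> m < q \<Longrightarrow> q < L \<Longrightarrow> a \<in> D l m \<Longrightarrow> b \<in> D m q \<Longrightarrow> a + b \<in> D l q"
  shows "partial_order_on (layers L n) (layer_order L n D)"
proof -
  have "refl_on (layers L n) (layer_order L n D)"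
    by (auto simp: refl_on_def layer_order_def)
  moreover have "layer_order L n D \<subseteq> layers L n \<times> layers L n"
    by (auto simp: layer_order_def)
  moreover have "antisym (layer_order L n D)"
    by (auto simp: antisym_def layer_order_def)
  moreover have "trans (layer_order L n D)"
  proof (rule transI)
    fix x y z assume xy: "(x, y) \<in> layer_order L n D" and yz: "(y, z) \<in> layer_order L n D"
    obtain l i m j q h where e: "x = (l, i)" "y = (m, j)" "z = (q, h)"
      by (cases x, cases y, cases z)
    from xy yz have mem: "x \<in> layers L n" "z \<in> layers L n" by (auto simp: layer_order_def)
    then have "q < L" by (simp add: e layers_def)
    consider "x = y" | "y = z" | "l < m" "m < q" using xy yz by (auto simp: e layer_order_def)
    then show "(x, z) \<in> layer_order L n D"
    proof cases
      case 3
      with xy obtain a where a: "a \<in> D l m" "[j - i = a] (mod int n)"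
        by (auto simp: e layer_order_def)
      from 3 yz obtain b where b: "b \<in> D m q" "[h - j = b] (mod int n)"
        by (auto simp: e layer_order_def)
      have "[h - i = a + b] (mod int n)" using cong_add[OF a(2) b(2)] by simp
      then show ?thesis
        using comp[OF 3 \<open>q < L\<close> a(1) b(1)] 3 mem unfolding e by (auto simp: layer_order_def)
    qed (use xy yz in auto)
  qed
  ultimately show ?thesis by (simp add: partial_order_on_def preorder_on_def)
qed

definition rotation :: "nat \<Rightarrow> nat \<Rightarrow> int \<Rightarrow> nat \<times> int \<Rightarrow> nat \<times> int" where
  "rotation L n t = (\<lambda>x\<in>layers L n. (fst x, (t + snd x) mod int n))"

lemma rotation_mod: "n > 0 \<Longrightarrow> l < L \<Longrightarrow> rotation L n t (l, i mod int n) = (l, (t + i) mod int n)"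
  by (simp add: rotation_def layers_mod mod_simps)

lemma rotation_aut:
  assumes "n > 0"
  shows "rotation L n t \<in> poset_auts (layers L n) (layer_order L n D)"
proof -
  have "bij_betw (rotation L n t) (layers L n) (layers L n)"
  proof (rule bij_betw_byWitness[where f' = "rotation L n (- t)"])
    show "\<forall>x\<in>layers L n. rotation L n (- t) (rotation L n t x) = x"
      using assms by (metis layers_cases rotation_mod minus_add_cancel)
    show "\<forall>x\<in>layers L n. rotation L n t (rotation L n (- t) x) = x"
      using assms by (metis layers_cases rotation_mod add_minus_cancel)
  qed (use assms in \<open>auto simp: rotation_def layers_def\<close>)
  moreover have "(x, y) \<in> layer_order L n D \<longleftrightarrow>
      (rotation L n t x, rotation L n t y) \<in> layer_order L n D"
    if x: "x \<in> layers L n" and y: "y \<in> layers L n" for x y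
  proof -
    from x obtain l i where "l < L" "x = (l, i mod int n)" by (rule layers_cases)
    moreover from y obtain m j where "m < L" "y = (m, j mod int n)" by (rule layers_cases)
    ultimately show ?thesis using assms
      by (simp add: rotation_mod layer_order_iff cong_add_lcancel)
  qed
  ultimately show ?thesis by (simp add: poset_auts_def Bij_def rotation_def)
qed

lemma aut_group_cyclic_if_rotations:
  assumes n: "n > 0" and L: "L > 0"
    and rot: "\<And>f. f \<in> poset_auts (layers L n) (layer_order L n D) \<Longrightarrow> \<exists>t. f = rotation L n t"
  shows "poset_aut_group (layers L n) (layer_order L n D) \<cong> integer_mod_group n"
proof -
  let ?P = "poset_auts (layers L n) (layer_order L n D)"
  let ?G = "poset_aut_group (layers L n) (layer_order L n D)"
  have cZ: "carrier (integer_mod_group n) = {0..<int n}"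
    and mZ: "x \<otimes>\<^bsub>integer_mod_group n\<^esub> y = (x + y) mod int n" for x y
    using n by (auto simp: integer_mod_group_def)
  have mod: "rotation L n (t mod int n) = rotation L n t" for t
    by (auto simp: rotation_def mod_simps)
  have inj: "inj_on (rotation L n) {0..<int n}"
  proof (rule inj_onI)
    fix s t assume "s \<in> {0..<int n}" "t \<in> {0..<int n}" "rotation L n s = rotation L n t"
    then show "s = t"
      using rotation_mod[OF n L, of s 0] rotation_mod[OF n L, of t 0] by simp
  qed
  have surj: "rotation L n ` {0..<int n} = ?P"
  proof (intro equalityI subsetI)
    fix f assume "f \<in> ?P"
    then obtain t where "f = rotation L n t" using rot by blast
    then have "f = rotation L n (t mod int n)" by (simp add: mod)
    then show "f \<in> rotation L n ` {0..<int n}" using n by auto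
  qed (use rotation_aut[OF n] in auto)
  have "compose (layers L n) (rotation L n s) (rotation L n t) = rotation L n (s + t)" for s t
  proof (rule extensionalityI[of _ "layers L n"])
    fix x assume x: "x \<in> layers L n"
    then obtain l i where "l < L" "x = (l, i mod int n)" by (rule layers_cases)
    then show "compose (layers L n) (rotation L n s) (rotation L n t) x = rotation L n (s + t) x"
      using x n by (simp add: compose_eq rotation_mod add.assoc)
  qed (simp_all add: rotation_def compose_def)
  moreover have "rotation L n t \<in> Bij (layers L n)" for t
    using rotation_aut[OF n] by (auto simp: poset_auts_def)
  ultimately have "rotation L n \<in> iso (integer_mod_group n) ?G"
    using inj surj rotation_aut[OF n, of L]
    by (auto simp: iso_def hom_def cZ mZ mod bij_betw_def poset_aut_group_def BijGroup_def)
  then have "integer_mod_group n \<cong> ?G" by (rule is_isoI)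
  then show ?thesis by (rule group.iso_sym[OF group_integer_mod_group])
qed

text \<open>
  If \<open>D l m\<close> is never empty, then the minimal points form the bottom layer and the maximal points form
  the top layer. For at most three layers this already identifies every layer by a property that
  automorphisms preserve.
\<close>

lemma nonmaximal_layer:
  assumes "n > 0" and ne: "\<forall>l m. l < m \<longrightarrow> m < L \<longrightarrow> D l m \<noteq> {}" and x: "x \<in> layers L n"
  shows "(\<exists>y\<in>layers L n. y \<noteq> x \<and> (x, y) \<in> layer_order L n D) \<longleftrightarrow> Suc (fst x) < L"
proof
  assume "\<exists>y\<in>layers L n. y \<noteq> x \<and> (x, y) \<in> layer_order L n D"
  then show "Suc (fst x) < L" by (auto simp: layer_order_def layers_def)
next
  obtain l i where li: "l < L" "x = (l, i mod int n)" using x by (rule layers_cases)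
  assume "Suc (fst x) < L"
  then have l: "Suc l < L" by (simp add: li)
  then have "D l (Suc l) \<noteq> {}" using ne[rule_format, of l "Suc l"] by simp
  then obtain d where "d \<in> D l (Suc l)" by blast
  then have "(x, (Suc l, (i + d) mod int n)) \<in> layer_order L n D"
    using l \<open>n > 0\<close> by (auto simp: li layer_order_iff intro!: bexI[of _ d])
  then show "\<exists>y\<in>layers L n. y \<noteq> x \<and> (x, y) \<in> layer_order L n D"
    using l \<open>n > 0\<close> by (intro bexI[of _ "(Suc l, (i + d) mod int n)"]) (auto simp: li layers_mod)
qed

lemma nonminimal_layer:
  assumes "n > 0" and ne: "\<forall>l m. l < m \<longrightarrow> m < L \<longrightarrow> D l m \<noteq> {}" and x: "x \<in> layers L n"
  shows "(\<exists>y\<in>layers L n. y \<noteq> x \<and> (y, x) \<in> layer_order L n D) \<longleftrightarrow> 0 < fst x"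
proof
  assume "\<exists>y\<in>layers L n. y \<noteq> x \<and> (y, x) \<in> layer_order L n D"
  then show "0 < fst x" by (auto simp: layer_order_def layers_def)
next
  obtain l i where li: "l < L" "x = (l, i mod int n)" using x by (rule layers_cases)
  assume "0 < fst x"
  then have l: "0 < l" by (simp add: li)
  then have "D 0 l \<noteq> {}" using ne[rule_format, of 0 l] li by simp
  then obtain d where "d \<in> D 0 l" by blast
  then have "((0, (i - d) mod int n), x) \<in> layer_order L n D"
    using l li \<open>n > 0\<close> by (auto simp: layer_order_iff intro!: bexI[of _ d])
  then show "\<exists>y\<in>layers L n. y \<noteq> x \<and> (y, x) \<in> layer_order L n D"
    using l li \<open>n > 0\<close> by (intro bexI[of _ "(0, (i - d) mod int n)"]) (auto simp: layers_mod)
qed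

lemma aut_preserves_layer:
  assumes "n > 0" and ne: "\<forall>l m. l < m \<longrightarrow> m < L \<longrightarrow> D l m \<noteq> {}" and "L \<le> 3"
    and f: "f \<in> poset_auts (layers L n) (layer_order L n D)" and x: "x \<in> layers L n"
  shows "fst (f x) = fst x"
proof -
  let ?A = "layers L n" and ?r = "layer_order L n D"
  have fA: "f ` ?A = ?A" using f by (auto simp: poset_auts_def Bij_def bij_betw_def)
  have fx: "f x \<in> ?A" using poset_aut_closed[OF f x] .
  have "(\<exists>y\<in>?A. y \<noteq> f x \<and> (f x, y) \<in> ?r) \<longleftrightarrow> (\<exists>y\<in>f ` ?A. y \<noteq> f x \<and> (f x, y) \<in> ?r)"
    by (simp only: fA)
  also have "\<dots> \<longleftrightarrow> (\<exists>y\<in>?A. y \<noteq> x \<and> (x, y) \<in> ?r)"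
    using x poset_aut_rel[OF f] poset_aut_inj[OF f] by auto
  finally have max: "Suc (fst (f x)) < L \<longleftrightarrow> Suc (fst x) < L"
    by (simp only: nonmaximal_layer[OF \<open>n > 0\<close> ne x] nonmaximal_layer[OF \<open>n > 0\<close> ne fx])
  have "(\<exists>y\<in>?A. y \<noteq> f x \<and> (y, f x) \<in> ?r) \<longleftrightarrow> (\<exists>y\<in>f ` ?A. y \<noteq> f x \<and> (y, f x) \<in> ?r)"
    by (simp only: fA)
  also have "\<dots> \<longleftrightarrow> (\<exists>y\<in>?A. y \<noteq> x \<and> (y, x) \<in> ?r)"
    using x poset_aut_rel[OF f] poset_aut_inj[OF f] by auto
  finally have min: "0 < fst (f x) \<longleftrightarrow> 0 < fst x"
    by (simp only: nonminimal_layer[OF \<open>n > 0\<close> ne x] nonminimal_layer[OF \<open>n > 0\<close> ne fx])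
  have "fst x < L" "fst (f x) < L" using x fx by (auto simp: layers_def)
  with max min \<open>L \<le> 3\<close> show ?thesis by arith
qed

text \<open>
  An automorphism is described by one function \<open>F l\<close> on the integers per layer, determined modulo \<open>n\<close>.
  Everything needed to prove rigidity then becomes a statement about congruences.
\<close>

lemma layer_aut_lift:
  assumes n: "n > 0" and ne: "\<forall>l m. l < m \<longrightarrow> m < L \<longrightarrow> D l m \<noteq> {}" and L: "L \<le> 3"
    and f: "f \<in> poset_auts (layers L n) (layer_order L n D)"
  obtains F :: "nat \<Rightarrow> int \<Rightarrow> int" where
    "\<forall>l<L. \<forall>i j. [F l i = F l j] (mod int n) \<longleftrightarrow> [i = j] (mod int n)"
    "\<forall>m<L. \<forall>l<m. \<forall>i j.
      (\<exists>d\<in>D l m. [F m j - F l i = d] (mod int n)) \<longleftrightarrow> (\<exists>d\<in>D l m. [j - i = d] (mod int n))"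
    "\<forall>t. (\<forall>l<L. \<forall>i. [F l i = t + i] (mod int n)) \<longrightarrow> f = rotation L n t"
proof
  define F where "F l i = snd (f (l, i mod int n))" for l i
  have fF: "f (l, i mod int n) = (l, F l i mod int n)" if "l < L" for l i
  proof -
    have "(l, i mod int n) \<in> layers L n" using that n by (simp add: layers_mod)
    from poset_aut_closed[OF f this] aut_preserves_layer[OF n ne L f this] show ?thesis
      by (cases "f (l, i mod int n)") (auto simp: F_def layers_def)
  qed
  show "\<forall>l<L. \<forall>i j. [F l i = F l j] (mod int n) \<longleftrightarrow> [i = j] (mod int n)"
  proof (intro allI impI)
    fix l i j assume "l < L"
    then show "[F l i = F l j] (mod int n) \<longleftrightarrow> [i = j] (mod int n)"
      using poset_aut_inj[OF f, of "(l, i mod int n)" "(l, j mod int n)"] n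
      by (simp add: layers_mod fF cong_def)
  qed
  show "\<forall>m<L. \<forall>l<m. \<forall>i j.
      (\<exists>d\<in>D l m. [F m j - F l i = d] (mod int n)) \<longleftrightarrow> (\<exists>d\<in>D l m. [j - i = d] (mod int n))"
  proof (intro allI impI)
    fix m l i j assume "m < L" "l < m"
    then show "(\<exists>d\<in>D l m. [F m j - F l i = d] (mod int n)) \<longleftrightarrow> (\<exists>d\<in>D l m. [j - i = d] (mod int n))"
      using poset_aut_rel[OF f, of "(l, i mod int n)" "(m, j mod int n)"] n
      by (simp add: layers_mod fF layer_order_iff)
  qed
  show "\<forall>t. (\<forall>l<L. \<forall>i. [F l i = t + i] (mod int n)) \<longrightarrow> f = rotation L n t"
  proof (intro allI impI)
    fix t assume t: "\<forall>l<L. \<forall>i. [F l i = t + i] (mod int n)"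
    show "f = rotation L n t"
    proof (rule extensionalityI[of _ "layers L n"])
      show "f \<in> extensional (layers L n)" using f by (simp add: poset_auts_def Bij_def)
      fix x assume "x \<in> layers L n"
      then obtain l i where "l < L" "x = (l, i mod int n)" by (rule layers_cases)
      then show "f x = rotation L n t x" using t n by (simp add: fF rotation_mod cong_def)
    qed (simp add: rotation_def)
  qed
qed

lemma unit_steps_cong:
  fixes F :: "int \<Rightarrow> int"
  assumes step: "\<And>i. [F (i + 1) = F i + e] (mod m)"
  shows "[F i = F 0 + e * i] (mod m)"
proof (induction i rule: int_induct[where k = 0])
  case (step1 i)
  then show ?case using cong_trans[OF step cong_add[OF step1(2) cong_refl[of e]]]
    by (simp add: algebra_simps)
next
  case (step2 i)
  have "[F (i - 1) + e = F 0 + e * i] (mod m)"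
    using cong_trans[OF cong_sym[OF step[of "i - 1"]]] step2(2) by simp
  from cong_diff[OF this cong_refl[of e]] show ?case by (simp add: algebra_simps)
qed simp

lemma cong_small_imp_eq:
  fixes a b :: int
  assumes "[a = b] (mod int n)" "\<bar>a - b\<bar> < int n"
  shows "a = b"
proof (rule ccontr)
  assume "a \<noteq> b"
  moreover have "int n dvd a - b" using assms(1) by (simp add: cong_iff_dvd_diff)
  ultimately have "int n \<le> \<bar>a - b\<bar>" by (simp add: zdvd_imp_le)
  with assms(2) show False by simp
qed

section \<open>Layered posets without further automorphisms\<close>

lemma antichain_two_aut:
  "poset_aut_group (layers 1 2) (layer_order 1 2 D) \<cong> integer_mod_group 2"
proof (rule aut_group_cyclic_if_rotations)
  fix f assume f: "f \<in> poset_auts (layers 1 2) (layer_order 1 2 D)"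
  have ne: "\<forall>l m. l < m \<longrightarrow> m < 1 \<longrightarrow> D l m \<noteq> {}" by simp
  obtain F where inj: "\<forall>l<1. \<forall>i j. [F l i = F l j] (mod int 2) \<longleftrightarrow> [i = j] (mod int 2)"
    and "\<forall>m<1. \<forall>l<m. \<forall>i j. (\<exists>d\<in>D l m. [F m j - F l i = d] (mod int 2)) \<longleftrightarrow>
      (\<exists>d\<in>D l m. [j - i = d] (mod int 2))"
    and rot: "\<forall>t. (\<forall>l<1. \<forall>i. [F l i = t + i] (mod int 2)) \<longrightarrow> f = rotation 1 2 t"
    by (rule layer_aut_lift[OF zero_less_numeral ne one_le_numeral f])
  have "[F 0 (i + 1) = F 0 i + 1] (mod int 2)" for i
  proof -
    have "\<not> [F 0 (i + 1) = F 0 i] (mod int 2)"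
      using inj by (simp add: cong_iff_dvd_diff)
    then show ?thesis by (simp add: cong_def) presburger
  qed
  from unit_steps_cong[of "F 0", OF this] have "[F 0 i = F 0 0 + i] (mod int 2)" for i by simp
  then show "\<exists>t. f = rotation 1 2 t" using rot by (metis less_one)
qed simp_all

text \<open>
  The difference 0 between consecutive layers forces all layers to move alike. The top point
  \<open>i + 1\<close> must then go to a point above the image of the bottom point \<open>i\<close>, which leaves only the
  images of \<open>i\<close> and \<open>i + 1\<close>; injectivity excludes the former.
\<close>

lemma three_layers_aut:
  fixes D :: "nat \<Rightarrow> nat \<Rightarrow> int set"
  assumes n: "n \<ge> 2"
  defines "D \<equiv> \<lambda>l m. if m = l + 2 then {0, 1} else {0}"
  shows "poset_aut_group (layers 3 n) (layer_order 3 n D) \<cong> integer_mod_group n"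
proof (rule aut_group_cyclic_if_rotations)
  fix f assume f: "f \<in> poset_auts (layers 3 n) (layer_order 3 n D)"
  have pos: "n > 0" and le: "3 \<le> (3 :: nat)" using n by simp_all
  have ne: "\<forall>l m. l < m \<longrightarrow> m < 3 \<longrightarrow> D l m \<noteq> {}" by (simp add: D_def)
  obtain F where inj: "\<forall>l<3. \<forall>i j. [F l i = F l j] (mod int n) \<longleftrightarrow> [i = j] (mod int n)"
    and rel: "\<forall>m<3. \<forall>l<m. \<forall>i j. (\<exists>d\<in>D l m. [F m j - F l i = d] (mod int n)) \<longleftrightarrow>
      (\<exists>d\<in>D l m. [j - i = d] (mod int n))"
    and rot: "\<forall>t. (\<forall>l<3. \<forall>i. [F l i = t + i] (mod int n)) \<longrightarrow> f = rotation 3 n t"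
    by (rule layer_aut_lift[OF pos ne le f])
  have F1: "[F 1 i = F 0 i] (mod int n)" for i
    using rel[rule_format, of 1 0 i i] by (simp add: D_def cong_diff_iff_cong_0)
  have F2: "[F 2 i = F 1 i] (mod int n)" for i
    using rel[rule_format, of 2 1 i i] by (simp add: D_def cong_diff_iff_cong_0)
  have F20: "[F 2 i = F 0 i] (mod int n)" for i using cong_trans[OF F2 F1] .
  have "[F 0 (i + 1) = F 0 i + 1] (mod int n)" for i
  proof -
    have "\<not> [i + 1 = i] (mod int n)" using n by (simp add: cong_iff_dvd_diff)
    then have "\<not> [F 0 (i + 1) = F 0 i] (mod int n)" using inj[rule_format, of 0] by simp
    moreover have "\<exists>d\<in>{0, 1}. [F 2 (i + 1) - F 0 i = d] (mod int n)"
      using rel[rule_format, of 2 0 "i + 1" i] by (simp add: D_def)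
    then obtain d where "d \<in> {0, 1}" and d: "[F 2 (i + 1) - F 0 i = d] (mod int n)" by blast
    have "[F 0 (i + 1) - F 0 i = d] (mod int n)"
      using cong_trans[OF cong_diff[OF cong_sym[OF F20] cong_refl] d] .
    from cong_add[OF this cong_refl[of "F 0 i"]]
    have "[F 0 (i + 1) = F 0 i + d] (mod int n)" by (simp add: add.commute)
    ultimately show ?thesis using \<open>d \<in> {0, 1}\<close> by auto
  qed
  from unit_steps_cong[of "F 0", OF this] have F0: "[F 0 i = F 0 0 + i] (mod int n)" for i by simp
  have "[F l i = F 0 0 + i] (mod int n)" if "l < 3" for l i
  proof -
    from that consider "l = 0" | "l = 1" | "l = 2" by linarith
    then show ?thesis using F0 cong_trans[OF F1 F0] cong_trans[OF F20 F0] by cases auto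
  qed
  then show "\<exists>t. f = rotation 3 n t" using rot by blast
qed (use n in simp_all)

text \<open>
  The nonzero differences of elements of \<open>{0, 1, 2, 5}\<close> are \<open>\<plusminus>1\<close>, occurring twice each, and
  \<open>\<plusminus>2, \<plusminus>3, \<plusminus>4, \<plusminus>5\<close>, occurring once each. Congruences between two such differences compare
  numbers at distance at most 10, so they are equalities for \<open>n \<ge> 11\<close>. Neighbours \<open>i, i + 1\<close> on the
  lower cycle have the two common upper bounds \<open>i + 1\<close> and \<open>i + 2\<close>, hence they go to neighbours, and the
  lower layer undergoes a rotation or a reflection. A reflection would require a translate of
  \<open>{0, -1, -2, -5}\<close> to be \<open>{0, 1, 2, 5}\<close>.
\<close>

lemma two_layers_aut:
  fixes D :: "nat \<Rightarrow> nat \<Rightarrow> int set"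
  assumes n: "n \<ge> 11"
  defines "D \<equiv> \<lambda>l m. {0, 1, 2, 5}"
  shows "poset_aut_group (layers 2 n) (layer_order 2 n D) \<cong> integer_mod_group n"
proof (rule aut_group_cyclic_if_rotations)
  let ?S = "{0, 1, 2, 5 :: int}"
  fix f assume f: "f \<in> poset_auts (layers 2 n) (layer_order 2 n D)"
  have pos: "n > 0" and le: "2 \<le> (3 :: nat)" using n by simp_all
  have ne: "\<forall>l m. l < m \<longrightarrow> m < 2 \<longrightarrow> D l m \<noteq> {}" by (simp add: D_def)
  obtain F where inj: "\<forall>l<2. \<forall>i j. [F l i = F l j] (mod int n) \<longleftrightarrow> [i = j] (mod int n)"
    and rel: "\<forall>m<2. \<forall>l<m. \<forall>i j. (\<exists>d\<in>D l m. [F m j - F l i = d] (mod int n)) \<longleftrightarrow>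
      (\<exists>d\<in>D l m. [j - i = d] (mod int n))"
    and rot: "\<forall>t. (\<forall>l<2. \<forall>i. [F l i = t + i] (mod int n)) \<longrightarrow> f = rotation 2 n t"
    by (rule layer_aut_lift[OF pos ne le f])
  have above: "\<exists>d\<in>?S. [F 1 j - F 0 i = d] (mod int n)" if "j - i \<in> ?S" for i j
    using rel[rule_format, of 1 0 j i] that unfolding D_def by auto
  have distinct: "\<not> [i = j] (mod int n)" if "\<bar>i - j\<bar> \<in> {1, 2}" for i j
    using cong_small_imp_eq[of i j n] that n by auto
  \<comment> \<open>The step \<open>F 0 (i + 1) - F 0 i\<close> is a difference of \<open>{0, 1, 2, 5}\<close> in two ways, so it is \<open>1\<close> or \<open>-1\<close>.\<close>
  have "\<exists>e\<in>{1, -1}. [F 0 (i + 1) = F 0 i + e] (mod int n)" for i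
  proof -
    obtain a where a: "a \<in> ?S" "[F 1 (i + 1) - F 0 i = a] (mod int n)"
      using above[of "i + 1" i] by auto
    obtain b where b: "b \<in> ?S" "[F 1 (i + 2) - F 0 i = b] (mod int n)"
      using above[of "i + 2" i] by auto
    obtain c where c: "c \<in> ?S" "[F 1 (i + 1) - F 0 (i + 1) = c] (mod int n)"
      using above[of "i + 1" "i + 1"] by auto
    obtain d where d: "d \<in> ?S" "[F 1 (i + 2) - F 0 (i + 1) = d] (mod int n)"
      using above[of "i + 2" "i + 1"] by auto
    have ac: "[F 0 (i + 1) - F 0 i = a - c] (mod int n)"
      using cong_diff[OF a(2) c(2)] by simp
    have bd: "[F 0 (i + 1) - F 0 i = b - d] (mod int n)"
      using cong_diff[OF b(2) d(2)] by simp
    have "a - c = b - d"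
      using cong_trans[OF cong_sym[OF ac] bd] by (rule cong_small_imp_eq) (use a b c d n in auto)
    moreover have "a \<noteq> b"
    proof
      assume "a = b"
      then have "[F 1 (i + 1) = F 1 (i + 2)] (mod int n)"
        using cong_diff[OF a(2) b(2)] by (simp add: cong_diff_iff_cong_0)
      then show False using inj[rule_format, of 1] distinct[of "i + 1" "i + 2"] by simp
    qed
    moreover have "a \<noteq> c"
    proof
      assume "a = c"
      then have "[F 0 (i + 1) = F 0 i] (mod int n)" using ac by (simp add: cong_diff_iff_cong_0)
      then show False using inj[rule_format, of 0] distinct[of "i + 1" i] by simp
    qed
    ultimately have "a - c \<in> {1, -1}" using a(1) b(1) c(1) d(1) by auto
    moreover have "[F 0 (i + 1) = F 0 i + (a - c)] (mod int n)"
      using cong_add[OF ac cong_refl[of "F 0 i"]] by (simp add: algebra_simps)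
    ultimately show ?thesis by blast
  qed
  then obtain e where e: "\<And>i. e i \<in> {1, -1}" "\<And>i. [F 0 (i + 1) = F 0 i + e i] (mod int n)"
    by metis
  \<comment> \<open>A change of direction would send \<open>i\<close> and \<open>i + 2\<close> to the same point.\<close>
  have same: "e (i + 1) = e i" for i
  proof (rule ccontr)
    assume "e (i + 1) \<noteq> e i"
    then have "e i + e (i + 1) = 0" using e(1)[of i] e(1)[of "i + 1"] by auto
    moreover have "[F 0 (i + 2) = F 0 i + e i + e (i + 1)] (mod int n)"
      using cong_trans[OF e(2)[of "i + 1"] cong_add[OF e(2)[of i] cong_refl]]
      by (simp add: add.assoc)
    ultimately have "[F 0 (i + 2) = F 0 i] (mod int n)" by (simp add: add.assoc)
    then show False using inj[rule_format, of 0] distinct[of "i + 2" i] by simp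
  qed
  have "e i = e 0" for i
    by (induction i rule: int_induct[where k = 0]) (use same same[of "i - 1" for i] in auto)
  with e have e0: "e 0 \<in> {1, -1}" and "[F 0 (i + 1) = F 0 i + e 0] (mod int n)" for i
    by metis+
  from unit_steps_cong[of "F 0", OF this(2)]
  have F0: "[F 0 i = F 0 0 + e 0 * i] (mod int n)" for i .
  \<comment> \<open>The lower bounds of the upper point \<open>j\<close> are \<open>j - s\<close> with \<open>s \<in> {0, 1, 2, 5}\<close>. Their images lie below
    the image of \<open>j\<close>, which translates \<open>e 0 * {0, 1, 2, 5}\<close> by \<open>c\<close> into \<open>{0, 1, 2, 5}\<close>; the only
    such translation is the trivial one with \<open>e 0 = 1\<close>.\<close>
  have F1: "e 0 = 1 \<and> [F 1 j = F 0 0 + e 0 * j] (mod int n)" for j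
  proof -
    define c where "c = F 1 j - F 0 0 - e 0 * j"
    have cS: "\<exists>d\<in>?S. [c + e 0 * s = d] (mod int n)" if s: "s \<in> ?S" for s
    proof -
      obtain d where "d \<in> ?S" and d: "[F 1 j - F 0 (j - s) = d] (mod int n)"
        using above[of j "j - s"] s by auto
      have "[F 1 j - (F 0 0 + e 0 * (j - s)) = d] (mod int n)"
        using cong_trans[OF cong_diff[OF cong_refl cong_sym[OF F0]] d] .
      then show ?thesis using \<open>d \<in> ?S\<close> by (auto simp: c_def algebra_simps)
    qed
    obtain a where a: "a \<in> ?S" "[c = a] (mod int n)" using cS[of 0] by auto
    have aS: "a + e 0 * s \<in> ?S" if s: "s \<in> ?S" for s
    proof -
      obtain d where d: "d \<in> ?S" "[c + e 0 * s = d] (mod int n)" using cS[OF s] by blast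
      have "[a + e 0 * s = d] (mod int n)"
        using cong_trans[OF cong_add[OF cong_sym[OF a(2)] cong_refl] d(2)] .
      then have "a + e 0 * s = d"
        by (rule cong_small_imp_eq) (use a(1) d(1) s e0 n in auto)
      then show ?thesis using d(1) by simp
    qed
    have small: "a \<in> ?S" "a + e 0 * 1 \<in> ?S" "a + e 0 * 2 \<in> ?S" "a + e 0 * 5 \<in> ?S"
      using aS[of 1] aS[of 2] aS[of 5] a(1) by blast+
    from e0 consider "e 0 = 1" | "e 0 = -1" by blast
    then have "e 0 = 1 \<and> a = 0"
    proof cases
      case 1
      with small show ?thesis unfolding 1 by simp arith
    next
      case 2
      have False using small unfolding 2 by simp arith
      then show ?thesis ..
    qed
    moreover have "[F 1 j = F 0 0 + e 0 * j + a] (mod int n)"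
      using cong_add[OF a(2) cong_refl[of "F 0 0 + e 0 * j"]] by (simp add: c_def algebra_simps)
    ultimately show ?thesis by simp
  qed
  have "[F l i = F 0 0 + i] (mod int n)" if "l < 2" for l i
  proof -
    from that consider "l = 0" | "l = 1" by linarith
    then show ?thesis using F0[of i] F1[of i] by cases auto
  qed
  then show "\<exists>t. f = rotation 2 n t" using rot by blast
qed (use n in simp_all)

lemma beta_two_le: "poset_beta (integer_mod_group 2) \<le> 2"
proof -
  have "partial_order_on (layers 1 2) (layer_order 1 2 (\<lambda>_ _. {}))"
    by (rule partial_order_layer_order) auto
  from poset_beta_le[OF finite_layers this antichain_two_aut] show ?thesis
    by (simp add: card_layers)
qed

lemma three_layers_realize:
  assumes n: "n \<ge> 2"
  obtains r where "partial_order_on (layers 3 n) r"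
    "poset_aut_group (layers 3 n) r \<cong> integer_mod_group n"
proof
  let ?r = "layer_order 3 n (\<lambda>l m. if m = l + 2 then {0, 1} else {0})"
  show "partial_order_on (layers 3 n) ?r"
    by (rule partial_order_layer_order) (use n in \<open>auto split: if_splits\<close>)
  show "poset_aut_group (layers 3 n) ?r \<cong> integer_mod_group n"
    by (rule three_layers_aut[OF n])
qed

lemma beta_le_three_times: "n \<ge> 2 \<Longrightarrow> poset_beta (integer_mod_group n) \<le> 3 * n"
  by (metis three_layers_realize poset_beta_le finite_layers card_layers)

lemma beta_le_twice:
  assumes n: "n \<ge> 11"
  shows "poset_beta (integer_mod_group n) \<le> 2 * n"
proof -
  have "partial_order_on (layers 2 n) (layer_order 2 n (\<lambda>_ _. {0, 1, 2, 5}))"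
    by (rule partial_order_layer_order) (use n in auto)
  from poset_beta_le[OF finite_layers this two_layers_aut[OF n]] show ?thesis
    by (simp add: card_layers)
qed

section \<open>Cyclic groups of prime power order\<close>

lemma smallest_cyclic_poset:
  assumes "n \<ge> 2"
  obtains A :: "nat set" and r act where "card A = poset_beta (integer_mod_group n)"
    "cyclic_poset A r n act"
proof -
  obtain r where "partial_order_on (layers 3 n) r"
    "poset_aut_group (layers 3 n) r \<cong> integer_mod_group n"
    using three_layers_realize[OF assms] .
  then obtain B :: "nat set" and s where B: "finite B" "card B = poset_beta (integer_mod_group n)"
    "partial_order_on B s" "poset_aut_group B s \<cong> integer_mod_group n"
    using poset_beta_attained[OF finite_layers] by metis
  have "\<exists>act. cyclic_poset B s n act"
    by (rule cyclic_posetI) (use B assms in simp_all)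
  with B(2) that show thesis by blast
qed

lemma prime_power_ge_two:
  assumes "prime (p :: nat)" "k \<ge> 1"
  shows "p ^ k \<ge> 2"
  using prime_ge_2_nat[OF assms(1)] self_le_power[of p k] assms(2) by linarith

lemma beta_ge_prime_power:
  assumes "prime p" "k \<ge> 1"
  shows "p ^ k \<le> poset_beta (integer_mod_group (p ^ k))"
proof -
  obtain A :: "nat set" and r act where A: "card A = poset_beta (integer_mod_group (p ^ k))"
    and "cyclic_poset A r (p ^ k) act"
    using smallest_cyclic_poset[OF prime_power_ge_two[OF assms]] .
  then interpret cyclic_poset A r "p ^ k" act by simp
  show ?thesis using card_ge_order[OF assms refl] A by simp
qed

lemma beta_ge_twice_prime_power:
  assumes "prime p" "k \<ge> 1" "p ^ k \<ge> 3"
  shows "2 * p ^ k \<le> poset_beta (integer_mod_group (p ^ k))"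
proof -
  obtain A :: "nat set" and r act where A: "card A = poset_beta (integer_mod_group (p ^ k))"
    and "cyclic_poset A r (p ^ k) act"
    using smallest_cyclic_poset[OF prime_power_ge_two[OF assms(1,2)]] .
  then interpret cyclic_poset A r "p ^ k" act by simp
  show ?thesis using card_ge_twice_order[OF assms(1,2) refl assms(3)] A by simp
qed

text \<open>
  Either the two-layer poset with \<open>2n\<close> points is available, or \<open>n\<close> is so small that the \<open>3n\<close> points of
  the three-layer poset already stay within the bound.
\<close>

lemma beta_le_with_excess:
  assumes "n \<ge> 2" and "n \<ge> 11 \<or> n \<le> c"
  shows "poset_beta (integer_mod_group n) \<le> 2 * n + c"
  using assms(2) beta_le_twice[of n] beta_le_three_times[OF assms(1)] by linarith

theorem theorem6:
  shows "poset_beta (integer_mod_group 2) = 2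
    \<and> (\<forall>k::nat. k \<ge> 2 \<longrightarrow>
          2 ^ (k + 1) \<le> poset_beta (integer_mod_group (2 ^ k))
        \<and> poset_beta (integer_mod_group (2 ^ k)) \<le> 2 ^ (k + 1) + 12)
    \<and> (\<forall>(p::nat) (k::nat). p \<in> {3, 5} \<and> k \<ge> 1 \<longrightarrow>
          2 * p ^ k \<le> poset_beta (integer_mod_group (p ^ k))
        \<and> poset_beta (integer_mod_group (p ^ k)) \<le> 2 * p ^ k + 3 * p)
    \<and> (\<forall>(p::nat) (k::nat). prime p \<and> p \<ge> 7 \<and> k \<ge> 1 \<longrightarrow>
          2 * p ^ k \<le> poset_beta (integer_mod_group (p ^ k))
        \<and> poset_beta (integer_mod_group (p ^ k)) \<le> 2 * p ^ k + p)"
proof (intro conjI allI impI)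
  show "poset_beta (integer_mod_group 2) = 2"
    using beta_two_le beta_ge_prime_power[of 2 1] by simp
next
  fix k :: nat assume k: "k \<ge> 2"
  then have "2 ^ 2 \<le> (2 :: nat) ^ k" by (intro power_increasing) auto
  then have "(2 :: nat) ^ k \<ge> 4" by simp
  moreover have "2 ^ k \<ge> (11 :: nat) \<or> 2 ^ k \<le> (12 :: nat)" by linarith
  ultimately show "2 ^ (k + 1) \<le> poset_beta (integer_mod_group (2 ^ k))"
    "poset_beta (integer_mod_group (2 ^ k)) \<le> 2 ^ (k + 1) + 12"
    using beta_ge_twice_prime_power[of 2 k] beta_le_with_excess[of "2 ^ k" 12] k by auto
next
  fix p k :: nat assume pk: "p \<in> {3, 5} \<and> k \<ge> 1"
  then have p: "prime p" by auto
  have pk3: "p ^ k \<ge> 3" using self_le_power[of p k] pk by auto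
  then show "2 * p ^ k \<le> poset_beta (integer_mod_group (p ^ k))"
    using beta_ge_twice_prime_power[OF p] pk by simp
  have "p ^ k \<ge> 11 \<or> p ^ k \<le> 3 * p"
  proof (cases "k \<le> 2")
    case True
    with pk have "k = 1 \<or> k = 2" by auto
    with pk show ?thesis by auto
  next
    case False
    have "3 ^ 3 \<le> p ^ 3" using pk by (intro power_mono) auto
    also have "\<dots> \<le> p ^ k" using False pk by (intro power_increasing) auto
    finally show ?thesis by simp
  qed
  then show "poset_beta (integer_mod_group (p ^ k)) \<le> 2 * p ^ k + 3 * p"
    using beta_le_with_excess[of "p ^ k" "3 * p"] pk3 by simp
next
  fix p k :: nat assume pk: "prime p \<and> p \<ge> 7 \<and> k \<ge> 1"
  then have pk7: "p ^ k \<ge> 7" using self_le_power[of p k] by linarith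
  then show "2 * p ^ k \<le> poset_beta (integer_mod_group (p ^ k))"
    using beta_ge_twice_prime_power[of p k] pk by simp
  have "p ^ k \<ge> 11 \<or> p ^ k \<le> p"
  proof (cases "k = 1")
    case False
    have "7 ^ 2 \<le> p ^ 2" using pk by (intro power_mono) auto
    also have "\<dots> \<le> p ^ k" using False pk by (intro power_increasing) auto
    finally show ?thesis by simp
  qed simp
  then show "poset_beta (integer_mod_group (p ^ k)) \<le> 2 * p ^ k + p"
    using beta_le_with_excess[of "p ^ k" p] pk7 by simp
qed

end
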